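(* Let $\phi\in\mathcal F$ be weakly unitarily invariant and normalized by $\phi(E)=1$, where $E=\mathrm{diag}(1,0,\ldots,0)\in\mathcal M$. Then the equality $m(\Delta;\mathcal S_\phi)=\lambda_n(\Delta)$ holds for every $\Delta\in\mathcal M^{\geq}$ if and only if $\phi(A)\leq\|A\|_2$ for all $A\in\mathcal M$.
   Context: $n$ is a positive integer, $\mathcal M$ is the algebra of complex $n\times n$ matrices, $\mathcal U\subset\mathcal M$ the set of unitary matrices, $\mathcal M^{\geq}\subset\mathcal M$ the cone of non-negative Hermitian (positive semidefinite) matrices. $\|A\|_2=(\mathrm{tr}(A^*A))^{1/2}$. For $\Delta\in\mathcal M^{\geq}$, $\lambda_n(\Delta)$ is its smallest eigenvalue. $\mathcal F$ is the set of all functions $f:\mathcal M\to[0,+\infty)$, not identically zero, that are positively homogeneous: $f(aA)=af(A)$ for all $a\in(0,+\infty)$, $A\in\mathcal M$, and $f(0)=0$. A function $\phi$ on $\mathcal M$ is right unitarily invariant if $\phi(AU)=\phi(A)$ for all $A\in\mathcal M$, $U\in\mathcal U$; unitary similarity invariant if $\phi(U^*AU)=\phi(A)$ for all $A\in\mathcal M$, $U\in\mathcal U$; and weakly unitarily invariant if it is right unitarily invariant or unitary similarity invariant. $\mathcal S_\phi=\{A\in\mathcal M:\phi(A)=1\}$. For a non-empty $\mathcal A\subseteq\mathcal M$, $m(\Delta;\mathcal A)$ denotes $\inf\{\mathrm{tr}(A\Delta A^* ):A\in\mathcal A\}$ when this infimum is attained; an assertion $m(\Delta;\mathcal A)=c$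 means that the infimum is attained and equals $c$. *)

theory Defs
  imports "Jordan_Normal_Form.Schur_Decomposition"
begin

text \<open>Complex \<open>n \<times> n\<close> matrices are the elements of \<^term>\<open>carrier_mat n n\<close>.
  Functions on them are total functions on \<^typ>\<open>complex mat\<close> of which only the values on
  \<^term>\<open>carrier_mat n n\<close> are ever mentioned.\<close>

definition trace :: "complex mat \<Rightarrow> complex" where
  "trace A = (\<Sum>i<dim_row A. A $$ (i, i))"

definition unitary_mats :: "nat \<Rightarrow> complex mat set" where
  "unitary_mats n =
     {U \<in> carrier_mat n n. U * mat_adjoint U = 1\<^sub>m n \<and> mat_adjoint U * U = 1\<^sub>m n}"

text \<open>Here \<open>(D *\<^sub>v v) \<bullet>c v\<close> is \<open>v\<^sup>* D v\<close>, which is real because \<open>D\<close> is Hermitian.\<close>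

definition psd_mats :: "nat \<Rightarrow> complex mat set" where
  "psd_mats n = {D \<in> carrier_mat n n. mat_adjoint D = D \<and>
     (\<forall>v \<in> carrier_vec n. 0 \<le> Re ((D *\<^sub>v v) \<bullet>c v))}"

text \<open>Meant for Hermitian matrices of positive size: all eigenvalues are then real, and the
  set below is finite and nonempty.\<close>

definition smallest_eigenvalue :: "complex mat \<Rightarrow> real" where
  "smallest_eigenvalue D = Min {x. eigenvalue D (complex_of_real x)}"

definition norm2 :: "complex mat \<Rightarrow> real" where
  "norm2 A = sqrt (Re (trace (mat_adjoint A * A)))"

definition pos_homogeneous_funs :: "nat \<Rightarrow> (complex mat \<Rightarrow> real) set" where
  "pos_homogeneous_funs n = {f.
     (\<forall>A \<in> carrier_mat n n. 0 \<le> f A) \<and>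
     (\<exists>A \<in> carrier_mat n n. f A \<noteq> 0) \<and>
     (\<forall>a > 0. \<forall>A \<in> carrier_mat n n. f (complex_of_real a \<cdot>\<^sub>m A) = a * f A) \<and>
     f (0\<^sub>m n n) = 0}"

definition right_unitarily_invariant :: "nat \<Rightarrow> (complex mat \<Rightarrow> real) \<Rightarrow> bool" where
  "right_unitarily_invariant n f \<longleftrightarrow>
     (\<forall>A \<in> carrier_mat n n. \<forall>U \<in> unitary_mats n. f (A * U) = f A)"

definition unitary_similarity_invariant :: "nat \<Rightarrow> (complex mat \<Rightarrow> real) \<Rightarrow> bool" where
  "unitary_similarity_invariant n f \<longleftrightarrow>
     (\<forall>A \<in> carrier_mat n n. \<forall>U \<in> unitary_mats n. f (mat_adjoint U * A * U) = f A)"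

definition weakly_unitarily_invariant :: "nat \<Rightarrow> (complex mat \<Rightarrow> real) \<Rightarrow> bool" where
  "weakly_unitarily_invariant n f \<longleftrightarrow>
     right_unitarily_invariant n f \<or> unitary_similarity_invariant n f"

definition unit_sphere :: "nat \<Rightarrow> (complex mat \<Rightarrow> real) \<Rightarrow> complex mat set" where
  "unit_sphere n f = {A \<in> carrier_mat n n. f A = 1}"

definition E_mat :: "nat \<Rightarrow> complex mat" where
  "E_mat n = mat_diag n (\<lambda>i. if i = 0 then 1 else 0)"

text \<open>For \<open>D \<in> psd_mats n\<close> and \<open>A\<close> of size \<open>n \<times> n\<close> the trace below is a nonnegative real,
  so the infimum in \<open>m_equals\<close> is over a set bounded below by \<open>0\<close>; \<open>m_equals D S c\<close> is the
  assertion \<open>m(D; S) = c\<close>: the infimum equals \<open>c\<close> and is attained (in particular \<open>S\<close> is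
  nonempty).\<close>

definition trace_form :: "complex mat \<Rightarrow> complex mat \<Rightarrow> real" where
  "trace_form D A = Re (trace (A * D * mat_adjoint A))"

definition m_equals :: "complex mat \<Rightarrow> complex mat set \<Rightarrow> real \<Rightarrow> bool" where
  "m_equals D S c \<longleftrightarrow> (INF A\<in>S. trace_form D A) = c \<and> (\<exists>A\<in>S. trace_form D A = c)"

end

theory Submission
  imports Defs "Jordan_Normal_Form.Spectral_Radius"
begin

text \<open>
  The identity matrix and the rank-one projection \<open>E\<close> carry the whole argument.

  If \<open>m(\<Delta>; S\<^sub>\<phi>) = \<lambda>\<^sub>n(\<Delta>)\<close> for all positive semidefinite \<open>\<Delta>\<close>, the instance
  \<open>\<Delta> = I\<close> reads \<open>tr(A A\<^sup>*) \<ge> 1\<close> whenever \<open>\<phi>(A) = 1\<close>. As \<open>tr(A A\<^sup>*)\<close> is the square of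
  the Frobenius norm, homogeneity turns this into \<open>\<phi>(A) \<le> norm2 A\<close> for every \<open>A\<close>.

  Conversely, let \<open>\<phi>\<close> be bounded by the Frobenius norm. In an orthonormal basis that
  diagonalizes \<open>\<Delta>\<close>, \<open>tr(A \<Delta> A\<^sup>*)\<close> is a sum of squared moduli of entries of \<open>A\<close>,
  weighted with eigenvalues of \<open>\<Delta>\<close>. Hence \<open>tr(A \<Delta> A\<^sup>*) \<ge> \<lambda>\<^sub>n(\<Delta>) (norm2 A)\<^sup>2\<close>
  (\<open>smallest_eigenvalue_le_trace_form\<close>), and this is at least \<open>\<lambda>\<^sub>n(\<Delta>)\<close> on \<open>S\<^sub>\<phi>\<close>
  because \<open>\<lambda>\<^sub>n(\<Delta>) \<ge> 0\<close> and \<open>norm2 A \<ge> \<phi>(A) = 1\<close> there. The bound is attained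
  (\<open>smallest_eigenvalue_attained\<close>): if \<open>U\<close> is unitary and its first column is an
  eigenvector for \<open>\<lambda>\<^sub>n(\<Delta>)\<close>, then both \<open>E U\<^sup>*\<close> and \<open>U E U\<^sup>*\<close> give the value
  \<open>\<lambda>\<^sub>n(\<Delta>)\<close>; the first lies in \<open>S\<^sub>\<phi>\<close> when \<open>\<phi>\<close> is right unitarily invariant, the second
  when it is unitary similarity invariant.

  The spectral theorem behind the lower bound (\<open>hermitian_diagonalization\<close>) is proved by
  deflation. Its main step, the completion of a unit vector to a unitary matrix
  (\<open>unitary_completion\<close>), also provides the \<open>U\<close> of the extremal matrices.
\<close>

section \<open>Adjoints and traces\<close>

lemma index_mat_adjoint [simp]:
  fixes A :: "complex mat"
  assumes "i < dim_col A" "j < dim_row A"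
  shows "mat_adjoint A $$ (i, j) = cnj (A $$ (j, i))"
  using assms by (simp add: mat_adjoint_def mat_of_rows_def)

lemma dim_mat_adjoint [simp]:
  "dim_row (mat_adjoint A) = dim_col A" "dim_col (mat_adjoint A) = dim_row A"
  by (simp_all add: mat_adjoint_def)

lemma mat_adjoint_carrier [simp]:
  "mat_adjoint A \<in> carrier_mat m n \<longleftrightarrow> A \<in> carrier_mat n m"
  unfolding carrier_mat_def mem_Collect_eq dim_mat_adjoint by (rule conj_commute)

lemma mat_adjoint_adjoint [simp]: "mat_adjoint (mat_adjoint A) = (A :: complex mat)"
  by (rule eq_matI) auto

lemma mat_adjoint_one [simp]: "mat_adjoint (1\<^sub>m n) = (1\<^sub>m n :: complex mat)"
  by (rule eq_matI) auto

lemma mat_adjoint_mult: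
  fixes A B :: "complex mat"
  assumes "A \<in> carrier_mat n m" "B \<in> carrier_mat m k"
  shows "mat_adjoint (A * B) = mat_adjoint B * mat_adjoint A"
  using assms by (intro eq_matI) (auto simp: scalar_prod_def mult.commute)

lemma trace_mult_comm:
  assumes "A \<in> carrier_mat n m" "B \<in> carrier_mat m n"
  shows "trace (A * B) = trace (B * A)"
proof -
  have "trace (A * B) = (\<Sum>i<n. \<Sum>j<m. A $$ (i, j) * B $$ (j, i))"
    using assms by (auto simp: trace_def scalar_prod_def atLeast0LessThan)
  also have "\<dots> = (\<Sum>j<m. \<Sum>i<n. B $$ (j, i) * A $$ (i, j))"
    by (subst sum.swap) (simp add: mult.commute)
  also have "\<dots> = trace (B * A)"
    using assms by (auto simp: trace_def scalar_prod_def atLeast0LessThan)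
  finally show ?thesis .
qed

lemma unitary_matsI:
  assumes "U \<in> carrier_mat n n" "mat_adjoint U * U = 1\<^sub>m n"
  shows "U \<in> unitary_mats n"
  using assms mat_mult_left_right_inverse[of "mat_adjoint U" n U]
  by (auto simp: unitary_mats_def)

lemma unitary_mats_carrier: "U \<in> unitary_mats n \<Longrightarrow> U \<in> carrier_mat n n"
  by (simp add: unitary_mats_def)

lemma mat_adjoint_unitary: "U \<in> unitary_mats n \<Longrightarrow> mat_adjoint U \<in> unitary_mats n"
  by (auto simp: unitary_mats_def)

lemma unitary_mult:
  assumes U: "U \<in> unitary_mats n" and V: "V \<in> unitary_mats n"
  shows "U * V \<in> unitary_mats n"
proof (rule unitary_matsI)
  note c = unitary_mats_carrier[OF U] unitary_mats_carrier[OF V]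
  show "U * V \<in> carrier_mat n n" using c by simp
  have "mat_adjoint (U * V) * (U * V) = mat_adjoint V * (mat_adjoint U * U) * V"
    using c by (simp add: mat_adjoint_mult[of _ n n _ n] assoc_mult_mat[of _ n n _ n _ n])
  also have "\<dots> = 1\<^sub>m n"
    using U V c by (simp add: unitary_mats_def)
  finally show "mat_adjoint (U * V) * (U * V) = 1\<^sub>m n" .
qed

section \<open>The trace form\<close>

text \<open>A change of basis in \<open>D\<close> can be moved to the argument \<open>A\<close>; this is how both the lower
  bound and its attainment reduce to diagonal or rank-one matrices.\<close>

lemma trace_form_congruence:
  assumes "A \<in> carrier_mat n n" "D \<in> carrier_mat n n" "U \<in> carrier_mat n n"
  shows "trace_form (U * D * mat_adjoint U) A = trace_form D (A * U)"
  using assms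
  by (simp add: trace_form_def mat_adjoint_mult[of _ n n _ n] assoc_mult_mat[of _ n n _ n _ n])

text \<open>By cyclicity of the trace, only \<open>A\<^sup>* A\<close> matters, and a unitary factor on the left of \<open>A\<close>
  cancels there.\<close>

lemma trace_form_unitary_left:
  assumes A: "A \<in> carrier_mat n n" and D: "D \<in> carrier_mat n n" and U: "U \<in> unitary_mats n"
  shows "trace_form D (U * A) = trace_form D A"
proof -
  note c = A D unitary_mats_carrier[OF U]
  have "trace (U * A * D * mat_adjoint (U * A)) = trace (U * (A * D * mat_adjoint A * mat_adjoint U))"
    using c by (simp add: mat_adjoint_mult[of _ n n _ n] assoc_mult_mat[of _ n n _ n _ n])
  also have "\<dots> = trace ((A * D * mat_adjoint A * mat_adjoint U) * U)"
    using c by (intro trace_mult_comm[of _ n n]) auto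
  also have "(A * D * mat_adjoint A * mat_adjoint U) * U = A * D * mat_adjoint A * (mat_adjoint U * U)"
    using c by (simp add: assoc_mult_mat[of _ n n _ n _ n])
  also have "\<dots> = A * D * mat_adjoint A"
    using U c by (simp add: unitary_mats_def)
  finally show ?thesis by (simp add: trace_form_def)
qed

lemma trace_form_mat_diag:
  assumes "A \<in> carrier_mat n n"
  shows "trace_form (mat_diag n (\<lambda>j. complex_of_real (d j))) A
           = (\<Sum>i<n. \<Sum>j<n. d j * (cmod (A $$ (i, j)))\<^sup>2)"
proof -
  have "Re (z * complex_of_real r * cnj z) = r * (cmod z)\<^sup>2" for z r
    unfolding cmod_power2 by (simp add: power2_eq_square algebra_simps)
  then show ?thesis
    using assms
    by (simp add: trace_form_def trace_def mat_diag_mult_right[of _ n n] scalar_prod_def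
        atLeast0LessThan)
qed

lemma trace_form_one:
  assumes "A \<in> carrier_mat n n"
  shows "trace_form (1\<^sub>m n) A = (\<Sum>i<n. \<Sum>j<n. (cmod (A $$ (i, j)))\<^sup>2)"
  using trace_form_mat_diag[OF assms, of "\<lambda>_. 1"] by simp

lemma norm2_eq_sqrt_trace_form:
  assumes "A \<in> carrier_mat n n"
  shows "norm2 A = sqrt (trace_form (1\<^sub>m n) A)"
  using assms by (simp add: norm2_def trace_form_def trace_mult_comm[of A n n])

lemma norm2_nonneg:
  assumes "A \<in> carrier_mat n n"
  shows "0 \<le> norm2 A"
  using assms by (simp add: norm2_eq_sqrt_trace_form trace_form_one sum_nonneg)

lemma norm2_sq:
  assumes "A \<in> carrier_mat n n"
  shows "(norm2 A)\<^sup>2 = trace_form (1\<^sub>m n) A"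
  using assms by (simp add: norm2_eq_sqrt_trace_form trace_form_one sum_nonneg)

lemma norm2_smult:
  assumes A: "A \<in> carrier_mat n n" and a: "a \<ge> 0"
  shows "norm2 (complex_of_real a \<cdot>\<^sub>m A) = a * norm2 A"
proof -
  have "trace_form (1\<^sub>m n) (complex_of_real a \<cdot>\<^sub>m A) = a\<^sup>2 * trace_form (1\<^sub>m n) A"
    using A by (simp add: trace_form_one norm_mult power_mult_distrib sum_distrib_left)
  then show ?thesis
    using A a by (simp add: norm2_eq_sqrt_trace_form[of _ n] real_sqrt_mult)
qed

text \<open>\<open>E D E\<close> keeps the top left entry of \<open>D\<close> and nothing else.\<close>

lemma trace_form_E_mat:
  assumes n: "n > 0" and D: "D \<in> carrier_mat n n"
  shows "trace_form D (E_mat n) = Re (D $$ (0, 0))"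
proof -
  have E: "mat_adjoint (E_mat n) = E_mat n"
    by (rule eq_matI) (auto simp: E_mat_def mat_diag_def)
  have "E_mat n * D * E_mat n = mat n n (\<lambda>(i, j). if i = 0 \<and> j = 0 then D $$ (0, 0) else 0)"
    using D unfolding E_mat_def
    by (simp add: mat_diag_mult_left[of _ n n] mat_diag_mult_right[of _ n n])
      (rule eq_matI; simp)
  then have "trace_form D (E_mat n) = Re (\<Sum>i<n. if i = 0 then D $$ (0, 0) else 0)"
    using E by (simp add: trace_form_def trace_def)
  then show ?thesis
    using n by simp
qed

section \<open>Orthonormal bases of eigenvectors\<close>

lemma conj_sprod_self:
  fixes v :: "complex vec"
  shows "v \<bullet>c v = complex_of_real (\<Sum>i<dim_vec v. (cmod (v $ i))\<^sup>2)"
  by (simp add: scalar_prod_def atLeast0LessThan flip: complex_norm_square)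

text \<open>Gram--Schmidt, started with \<open>v\<close>, leaves \<open>v\<close> in first place and yields orthogonal but
  unnormalized vectors. Dividing each by its length gives the columns of \<open>U\<close>; the first
  one is unchanged because \<open>v\<close> is a unit vector.\<close>

lemma unitary_completion:
  fixes v :: "complex vec"
  assumes v: "v \<in> carrier_vec n" and unit: "v \<bullet>c v = 1"
  obtains U where "U \<in> unitary_mats n" "col U 0 = v"
proof -
  have v0: "v \<noteq> 0\<^sub>v n" using unit v by auto
  interpret cof_vec_space n "TYPE(complex)" .
  define b where "b = basis_completion v"
  define ws where "ws = gram_schmidt n b"
  from basis_completion[OF v v0, folded b_def]
  have dist_b: "distinct b" and indep: "\<not> lin_dep (set b)" and b: "set b \<subseteq> carrier_vec n"
    and hdb: "hd b = v" and len_b: "length b = n" by auto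
  from v unit have n: "n > 0" by (auto simp: scalar_prod_def intro: gr0I)
  from hdb len_b n obtain vs where bv: "b = v # vs" by (cases b) auto
  from gram_schmidt_result[OF b dist_b indep refl, folded ws_def]
  have ws: "set ws \<subseteq> carrier_vec n" "corthogonal ws" "length ws = n"
    by (auto simp: len_b)
  have hdws: "ws ! 0 = v"
    using gram_schmidt_hd[OF v, of vs, folded bv] ws n by (cases ws) (auto simp: ws_def)
  have dimw: "dim_vec (ws ! j) = n" if "j < n" for j
    using ws that nth_mem by fastforce
  define c where "c j = (\<Sum>i<n. (cmod (ws ! j $ i))\<^sup>2)" for j
  have self: "ws ! j \<bullet>c ws ! j = complex_of_real (c j)" if "j < n" for j
    using conj_sprod_self[of "ws ! j"] dimw[OF that] by (simp add: c_def)
  have c_pos: "c j > 0" if "j < n" for j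
  proof -
    have "c j \<noteq> 0" using corthogonalD[OF ws(2), of j j] self that ws(3) by auto
    moreover have "c j \<ge> 0" by (simp add: c_def sum_nonneg)
    ultimately show ?thesis by simp
  qed
  define U where "U = mat n n (\<lambda>(i, j). ws ! j $ i / complex_of_real (sqrt (c j)))"
  have U: "U \<in> carrier_mat n n" by (simp add: U_def)
  have "mat_adjoint U * U = 1\<^sub>m n"
  proof (rule eq_matI)
    fix i j assume "i < dim_row (1\<^sub>m n :: complex mat)" "j < dim_col (1\<^sub>m n :: complex mat)"
    then have ij: "i < n" "j < n" by auto
    have "(mat_adjoint U * U) $$ (i, j)
        = (\<Sum>k<n. cnj (ws ! i $ k) * ws ! j $ k) / (complex_of_real (sqrt (c i)) * complex_of_real (sqrt (c j)))"
      using ij by (simp add: U_def scalar_prod_def atLeast0LessThan sum_divide_distrib)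
    also have "(\<Sum>k<n. cnj (ws ! i $ k) * ws ! j $ k) = ws ! j \<bullet>c ws ! i"
      using ij dimw by (simp add: scalar_prod_def atLeast0LessThan mult.commute)
    also have "ws ! j \<bullet>c ws ! i / (complex_of_real (sqrt (c i)) * complex_of_real (sqrt (c j)))
        = (if i = j then 1 else 0)"
    proof (cases "i = j")
      case True
      have "complex_of_real (sqrt (c j)) * complex_of_real (sqrt (c j)) = complex_of_real (c j)"
        using c_pos[OF ij(2)] by (metis of_real_mult real_sqrt_mult_self abs_of_pos)
      then show ?thesis using True c_pos[OF ij(2)] self[OF ij(2)] by simp
    next
      case False
      then show ?thesis using corthogonalD[OF ws(2), of j i] ij ws(3) by simp
    qed
    finally show "(mat_adjoint U * U) $$ (i, j) = (1\<^sub>m n :: complex mat) $$ (i, j)"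
      using ij by simp
  qed (auto simp: U_def)
  moreover have "col U 0 = v"
  proof -
    have "c 0 = 1" using self[OF n] unit hdws by (metis of_real_eq_1_iff)
    then show ?thesis using v n hdws by (intro eq_vecI) (auto simp: U_def)
  qed
  ultimately show ?thesis using that unitary_matsI[OF U] by blast
qed

lemma unit_eigenvector:
  fixes A :: "complex mat"
  assumes A: "A \<in> carrier_mat n n" and e: "eigenvalue A e"
  obtains v where "v \<in> carrier_vec n" "v \<bullet>c v = 1" "A *\<^sub>v v = e \<cdot>\<^sub>v v"
proof -
  obtain w where w: "w \<in> carrier_vec n" "w \<noteq> 0\<^sub>v n" "A *\<^sub>v w = e \<cdot>\<^sub>v w"
    using e A by (auto simp: eigenvalue_def eigenvector_def)
  define c where "c = (\<Sum>i<n. (cmod (w $ i))\<^sup>2)"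
  have self: "w \<bullet>c w = complex_of_real c" using conj_sprod_self[of w] w by (simp add: c_def)
  have "c \<noteq> 0" using self w conjugate_square_eq_0_vec[of w n] by auto
  then have c: "c > 0" by (simp add: c_def sum_nonneg less_le)
  define r where "r = complex_of_real (1 / sqrt c)"
  show ?thesis
  proof (rule that[of "r \<cdot>\<^sub>v w"])
    show "r \<cdot>\<^sub>v w \<in> carrier_vec n" using w by simp
    have "(r \<cdot>\<^sub>v w) \<bullet>c (r \<cdot>\<^sub>v w) = r * cnj r * (w \<bullet>c w)"
      using w by (simp add: scalar_prod_def sum_distrib_left algebra_simps)
    also have "r * cnj r = complex_of_real (1 / c)"
      using c by (simp add: r_def flip: of_real_mult)
    finally show "(r \<cdot>\<^sub>v w) \<bullet>c (r \<cdot>\<^sub>v w) = 1" using c self by simp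
    show "A *\<^sub>v (r \<cdot>\<^sub>v w) = e \<cdot>\<^sub>v (r \<cdot>\<^sub>v w)"
      using A w by (simp add: mult_mat_vec smult_smult_assoc mult.commute)
  qed
qed

text \<open>Conjugation by \<open>U\<close> deflates: an eigenvector in the first column of \<open>U\<close> becomes the
  first unit vector.\<close>

lemma eigenvector_rotation:
  assumes A: "A \<in> carrier_mat n n" and U: "U \<in> unitary_mats n" and n: "n > 0"
    and ev: "A *\<^sub>v col U 0 = e \<cdot>\<^sub>v col U 0"
    and i: "i < n"
  shows "(mat_adjoint U * A * U) $$ (i, 0) = (if i = 0 then e else 0)"
proof -
  note c = A unitary_mats_carrier[OF U]
  have 1: "col (A * U) 0 = e \<cdot>\<^sub>v col U 0"
    using c n ev by (subst col_mult2[of _ n n _ n]) auto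
  have "mat_adjoint U * A * U = mat_adjoint U * (A * U)"
    using c by (simp add: assoc_mult_mat[of _ n n _ n _ n])
  then have "(mat_adjoint U * A * U) $$ (i, 0) = row (mat_adjoint U) i \<bullet> col (A * U) 0"
    using c i n by simp
  also have "\<dots> = e * (row (mat_adjoint U) i \<bullet> col U 0)"
    unfolding 1 using c by (intro scalar_prod_smult_distrib[of _ n] carrier_vecI) auto
  also have "row (mat_adjoint U) i \<bullet> col U 0 = (mat_adjoint U * U) $$ (i, 0)"
    using c i n by simp
  finally show ?thesis using U i n by (simp add: unitary_mats_def)
qed

text \<open>Induction on the size. Conjugation by a unitary matrix whose first column is an
  eigenvector makes the first column a multiple of the first unit vector. Hermitian symmetry
  clears the first row as well and makes the eigenvalue real, so that the lower right
  block is a smaller Hermitian matrix.\<close>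

lemma hermitian_diagonalization:
  assumes "A \<in> carrier_mat n n" and "mat_adjoint A = A"
  shows "\<exists>U \<in> unitary_mats n. \<exists>d :: nat \<Rightarrow> real.
           A = U * mat_diag n (\<lambda>i. complex_of_real (d i)) * mat_adjoint U"
  using assms
proof (induction n arbitrary: A)
  case 0
  then show ?case
    by (intro bexI[of _ "1\<^sub>m 0"] exI[of _ "\<lambda>_. 0"] eq_matI) (auto intro: unitary_matsI)
next
  case (Suc n)
  note A = Suc.prems(1)
  obtain e where "eigenvalue A e"
    using spectrum_non_empty[OF A] by (auto simp: spectrum_def)
  then obtain v where v: "v \<in> carrier_vec (Suc n)" "v \<bullet>c v = 1" "A *\<^sub>v v = e \<cdot>\<^sub>v v"
    by (rule unit_eigenvector[OF A])
  obtain W where W: "W \<in> unitary_mats (Suc n)" "col W 0 = v"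
    by (rule unitary_completion[OF v(1,2)])
  note Wc = unitary_mats_carrier[OF W(1)]
  define B where "B = mat_adjoint W * A * W"
  have B: "B \<in> carrier_mat (Suc n) (Suc n)" using A Wc by (simp add: B_def)
  have "mat_adjoint B = B"
    using A Wc Suc.prems(2)
    by (simp add: B_def mat_adjoint_mult[of _ "Suc n" "Suc n" _ "Suc n"]
        assoc_mult_mat[of _ "Suc n" "Suc n" _ "Suc n" _ "Suc n"])
  then have herm: "cnj (B $$ (j, i)) = B $$ (i, j)" if "i < Suc n" "j < Suc n" for i j
    using B that by (metis carrier_matD index_mat_adjoint)
  have col0: "B $$ (i, 0) = (if i = 0 then e else 0)" if "i < Suc n" for i
    using eigenvector_rotation[OF A W(1)] v W(2) that by (simp add: B_def)
  have row0: "B $$ (0, i) = (if i = 0 then e else 0)" if "i < Suc n" for i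
    using herm[of 0 i] herm[of 0 0] col0[OF that] col0[of 0] that by (auto split: if_splits)
  have e: "complex_of_real (Re e) = e"
    using herm[of 0 0] col0[of 0] by (simp add: complex_eq_iff)
  define C where "C = mat n n (\<lambda>(i, j). B $$ (Suc i, Suc j))"
  have C: "C \<in> carrier_mat n n" by (simp add: C_def)
  have "mat_adjoint C = C"
    using herm by (intro eq_matI) (auto simp: C_def)
  from Suc.IH[OF C this] obtain P d where P: "P \<in> unitary_mats n"
    and CP: "C = P * mat_diag n (\<lambda>i. complex_of_real (d i)) * mat_adjoint P" by blast
  note Pc = unitary_mats_carrier[OF P]
  \<comment> \<open>\<open>blk x M\<close> is \<open>diag(x, M)\<close>. Products and adjoints act on the two blocks separately, so the
    diagonalization of \<open>C\<close> extends to one of \<open>B = diag(e, C)\<close>.\<close>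
  let ?blk = "\<lambda>x M. four_block_mat (x \<cdot>\<^sub>m 1\<^sub>m 1) (0\<^sub>m 1 n) (0\<^sub>m n 1) (M :: complex mat)"
  have scalar_mult: "(x \<cdot>\<^sub>m 1\<^sub>m 1) * (y \<cdot>\<^sub>m 1\<^sub>m 1) = ((x * y) \<cdot>\<^sub>m 1\<^sub>m 1 :: complex mat)" for x y
    by (rule eq_matI) (simp_all add: scalar_prod_def)
  have blk_mult: "?blk x M * ?blk y N = ?blk (x * y) (M * N)"
    if M: "M \<in> carrier_mat n n" and N: "N \<in> carrier_mat n n" for x y M N
  proof -
    have S: "z \<cdot>\<^sub>m 1\<^sub>m 1 \<in> carrier_mat 1 1" for z :: complex by simp
    have MN: "M * N \<in> carrier_mat n n" using M N by (rule mult_carrier_mat)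
    show ?thesis
      unfolding mult_four_block_mat[OF S zero_carrier_mat zero_carrier_mat M S zero_carrier_mat
          zero_carrier_mat N] scalar_mult
      using M N MN
      by (simp add: left_mult_zero_mat[of _ n] right_mult_zero_mat[of _ n])
  qed
  define d' where "d' = case_nat (Re e) d"
  define Q where "Q = ?blk 1 P"
  have Qc: "Q \<in> carrier_mat (Suc n) (Suc n)"
    using four_block_carrier_mat[OF _ Pc, of "1 \<cdot>\<^sub>m 1\<^sub>m 1" 1 1] by (simp add: Q_def)
  have Pa: "mat_adjoint P \<in> carrier_mat n n" using Pc by simp
  have Qa: "mat_adjoint Q = ?blk 1 (mat_adjoint P)"
    using Pc by (intro eq_matI) (auto simp: Q_def)
  have blk1: "?blk 1 (1\<^sub>m n) = 1\<^sub>m (Suc n)"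
    by (intro eq_matI) auto
  have Q: "Q \<in> unitary_mats (Suc n)"
  proof (rule unitary_matsI[OF Qc])
    show "mat_adjoint Q * Q = 1\<^sub>m (Suc n)"
      unfolding Qa unfolding Q_def blk_mult[OF Pa Pc] using P blk1 by (simp add: unitary_mats_def)
  qed
  have diag: "mat_diag (Suc n) (\<lambda>i. complex_of_real (d' i)) = ?blk e (mat_diag n (\<lambda>i. complex_of_real (d i)))"
    by (intro eq_matI) (auto simp: mat_diag_def d'_def e split: nat.splits)
  have Bblk: "B = ?blk e C"
    using B row0 col0 by (intro eq_matI) (auto simp: C_def)
  have BQ: "B = Q * mat_diag (Suc n) (\<lambda>i. complex_of_real (d' i)) * mat_adjoint Q"
    unfolding diag Qa unfolding Q_def Bblk CP
    by (simp only: blk_mult[OF Pc mat_diag_dim] blk_mult[OF mult_carrier_mat[OF Pc mat_diag_dim] Pa]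
        mult_1_left mult_1_right)
  have "W * B * mat_adjoint W = (W * mat_adjoint W) * A * (W * mat_adjoint W)"
    using A Wc by (simp add: B_def assoc_mult_mat[of _ "Suc n" "Suc n" _ "Suc n" _ "Suc n"])
  also have "\<dots> = A" using W(1) A by (simp add: unitary_mats_def)
  finally have "A = W * B * mat_adjoint W" ..
  also have "\<dots> = (W * Q) * mat_diag (Suc n) (\<lambda>i. complex_of_real (d' i)) * mat_adjoint (W * Q)"
    unfolding BQ using Wc Qc
    by (simp add: mat_adjoint_mult[of _ "Suc n" "Suc n" _ "Suc n"]
        assoc_mult_mat[of _ "Suc n" "Suc n" _ "Suc n" _ "Suc n"]
        mult_carrier_mat[of _ "Suc n" "Suc n" _ "Suc n"])
  finally have "A = (W * Q) * mat_diag (Suc n) (\<lambda>i. complex_of_real (d' i)) * mat_adjoint (W * Q)" .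
  with unitary_mult[OF W(1) Q] show ?case by blast
qed

section \<open>The smallest eigenvalue\<close>

lemma diagonalization_eigenvalue:
  assumes U: "U \<in> unitary_mats n" and i: "i < n"
  shows "eigenvalue (U * mat_diag n d * mat_adjoint U) (d i)"
proof -
  note Uc = unitary_mats_carrier[OF U]
  note UD = mult_carrier_mat[OF Uc mat_diag_dim[of n d]]
  have UDU: "U * mat_diag n d * mat_adjoint U \<in> carrier_mat n n"
    using Uc by (intro mult_carrier_mat[OF UD]) simp
  have "U * mat_diag n d * mat_adjoint U * U = U * mat_diag n d * (mat_adjoint U * U)"
    using Uc by (simp add: assoc_mult_mat[of _ n n _ n _ n] mult_carrier_mat[of _ n n _ n])
  also have "\<dots> = U * mat_diag n d"
    using U right_mult_one_mat[OF UD] by (simp add: unitary_mats_def)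
  finally have eq: "U * mat_diag n d * mat_adjoint U * U = U * mat_diag n d" .
  have "(U * mat_diag n d * mat_adjoint U) *\<^sub>v col U i = col (U * mat_diag n d * mat_adjoint U * U) i"
    by (rule col_mult2[OF UDU Uc i, symmetric])
  also have "\<dots> = d i \<cdot>\<^sub>v col U i"
    unfolding eq using Uc i by (intro eq_vecI) (auto simp: mat_diag_mult_right[of _ n n])
  finally have 1: "(U * mat_diag n d * mat_adjoint U) *\<^sub>v col U i = d i \<cdot>\<^sub>v col U i" .
  have "col U i \<noteq> 0\<^sub>v n"
  proof
    assume 0: "col U i = 0\<^sub>v n"
    have "(mat_adjoint U * U) $$ (i, i) = row (mat_adjoint U) i \<bullet> col U i" using Uc i by simp
    also have "\<dots> = 0" unfolding 0 using Uc i by (intro scalar_prod_right_zero carrier_vecI) auto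
    finally show False using U i by (simp add: unitary_mats_def)
  qed
  with 1 Uc i show ?thesis
    by (auto simp: eigenvalue_def eigenvector_def intro!: exI[of _ "col U i"])
qed

lemma finite_real_eigenvalues:
  assumes "A \<in> carrier_mat n n"
  shows "finite {x. eigenvalue A (complex_of_real x)}"
proof -
  have "finite (complex_of_real -` spectrum A)"
    by (rule finite_vimageI[OF card_finite_spectrum(1)[OF assms]]) (simp add: inj_on_def)
  then show ?thesis by (simp add: spectrum_def vimage_def)
qed

text \<open>In an orthonormal eigenbasis \<open>U\<close>, the trace form and the squared Frobenius norm are sums
  of the same squares \<open>\<bar>(X U)\<^sub>i\<^sub>j\<bar>\<^sup>2\<close>, in the first case weighted with eigenvalues.
  All these weights are real eigenvalues, so the minimum that defines the smallest eigenvalue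
  is over a nonempty set and bounds each of them from below.\<close>

lemma
  assumes n: "n > 0" and A: "A \<in> carrier_mat n n" and herm: "mat_adjoint A = A"
  shows eigenvalue_smallest_eigenvalue: "eigenvalue A (complex_of_real (smallest_eigenvalue A))"
    and smallest_eigenvalue_le_trace_form:
      "X \<in> carrier_mat n n \<Longrightarrow> smallest_eigenvalue A * (norm2 X)\<^sup>2 \<le> trace_form A X"
proof -
  obtain U d where U: "U \<in> unitary_mats n"
    and AU: "A = U * mat_diag n (\<lambda>i. complex_of_real (d i)) * mat_adjoint U"
    using hermitian_diagonalization[OF A herm] by blast
  note Uc = unitary_mats_carrier[OF U]
  let ?S = "{x. eigenvalue A (complex_of_real x)}"
  have d: "d i \<in> ?S" if "i < n" for i
    using diagonalization_eigenvalue[OF U that, of "\<lambda>i. complex_of_real (d i)"] AU by simp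
  note fin = finite_real_eigenvalues[OF A]
  show "eigenvalue A (complex_of_real (smallest_eigenvalue A))"
    using Min_in[OF fin] d[OF n] by (auto simp: smallest_eigenvalue_def)
  have le: "smallest_eigenvalue A \<le> d i" if "i < n" for i
    unfolding smallest_eigenvalue_def using fin d[OF that] by (rule Min_le)
  assume X: "X \<in> carrier_mat n n"
  have XU: "X * U \<in> carrier_mat n n" using X Uc by simp
  have "(norm2 X)\<^sup>2 = trace_form (U * 1\<^sub>m n * mat_adjoint U) X"
    using norm2_sq[OF X] U Uc by (simp add: unitary_mats_def)
  also have "\<dots> = trace_form (1\<^sub>m n) (X * U)"
    by (rule trace_form_congruence[OF X one_carrier_mat Uc])
  also have "\<dots> = (\<Sum>i<n. \<Sum>j<n. (cmod ((X * U) $$ (i, j)))\<^sup>2)"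
    by (rule trace_form_one[OF XU])
  finally have "smallest_eigenvalue A * (norm2 X)\<^sup>2
      = (\<Sum>i<n. \<Sum>j<n. smallest_eigenvalue A * (cmod ((X * U) $$ (i, j)))\<^sup>2)"
    by (simp add: sum_distrib_left)
  also have "\<dots> \<le> (\<Sum>i<n. \<Sum>j<n. d j * (cmod ((X * U) $$ (i, j)))\<^sup>2)"
    by (intro sum_mono mult_right_mono le) auto
  also have "\<dots> = trace_form A X"
    unfolding trace_form_mat_diag[OF XU, symmetric] AU using X Uc
    by (simp add: trace_form_congruence)
  finally show "smallest_eigenvalue A * (norm2 X)\<^sup>2 \<le> trace_form A X" .
qed

text \<open>The smallest eigenvalue is the value of the quadratic form at a unit eigenvector.\<close>

lemma smallest_eigenvalue_nonneg:
  assumes n: "n > 0" and D: "D \<in> psd_mats n"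
  shows "0 \<le> smallest_eigenvalue D"
proof -
  have c: "D \<in> carrier_mat n n" "mat_adjoint D = D" using D by (auto simp: psd_mats_def)
  obtain v where v: "v \<in> carrier_vec n" "v \<bullet>c v = 1"
    "D *\<^sub>v v = complex_of_real (smallest_eigenvalue D) \<cdot>\<^sub>v v"
    by (rule unit_eigenvector[OF c(1) eigenvalue_smallest_eigenvalue[OF n c]])
  have "(D *\<^sub>v v) \<bullet>c v = complex_of_real (smallest_eigenvalue D)"
    unfolding v(3) using v(1,2) by simp
  moreover have "0 \<le> Re ((D *\<^sub>v v) \<bullet>c v)"
    using D v(1) unfolding psd_mats_def by blast
  ultimately show ?thesis by simp
qed

lemma smallest_eigenvalue_one:
  assumes n: "n > 0"
  shows "smallest_eigenvalue (1\<^sub>m n) = 1"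
proof -
  have "eigenvalue (1\<^sub>m n) (complex_of_real (smallest_eigenvalue (1\<^sub>m n)))"
    using n by (intro eigenvalue_smallest_eigenvalue) auto
  then obtain v where v: "v \<in> carrier_vec n" "v \<bullet>c v = 1"
    "1\<^sub>m n *\<^sub>v v = complex_of_real (smallest_eigenvalue (1\<^sub>m n)) \<cdot>\<^sub>v v"
    by (rule unit_eigenvector[rotated]) auto
  have "complex_of_real (smallest_eigenvalue (1\<^sub>m n)) * (v \<bullet>c v) = (1\<^sub>m n *\<^sub>v v) \<bullet>c v"
    unfolding v(3) using v(1) by simp
  then show ?thesis using v(1,2) by simp
qed

section \<open>The infimum over the unit sphere\<close>

text \<open>For \<open>U\<close> unitary with an eigenvector of the smallest eigenvalue in its first column,
  the value of the trace form at \<open>E U\<^sup>*\<close> is the top left entry of \<open>U\<^sup>* D U\<close>, which is that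
  eigenvalue. The extra factor in \<open>U E U\<^sup>*\<close>, needed if \<open>\<phi>\<close> is only invariant under
  similarity, does not change the value.\<close>

lemma smallest_eigenvalue_attained:
  assumes n: "n > 0" and inv: "weakly_unitarily_invariant n \<phi>" and E: "\<phi> (E_mat n) = 1"
    and D: "D \<in> carrier_mat n n" "mat_adjoint D = D"
  shows "\<exists>A \<in> unit_sphere n \<phi>. trace_form D A = smallest_eigenvalue D"
proof -
  have Ec: "E_mat n \<in> carrier_mat n n" by (simp add: E_mat_def)
  obtain v where v: "v \<in> carrier_vec n" "v \<bullet>c v = 1"
    "D *\<^sub>v v = complex_of_real (smallest_eigenvalue D) \<cdot>\<^sub>v v"
    by (rule unit_eigenvector[OF D(1) eigenvalue_smallest_eigenvalue[OF n D]])
  obtain U where U: "U \<in> unitary_mats n" "col U 0 = v"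
    by (rule unitary_completion[OF v(1,2)])
  note Uc = unitary_mats_carrier[OF U(1)]
  note Ua = mat_adjoint_unitary[OF U(1)]
  have "trace_form D (E_mat n * mat_adjoint U) = trace_form (mat_adjoint U * D * U) (E_mat n)"
    using trace_form_congruence[OF Ec D(1), of "mat_adjoint U"] Uc by simp
  also have "\<dots> = Re ((mat_adjoint U * D * U) $$ (0, 0))"
    using n D Uc by (intro trace_form_E_mat) auto
  also have "\<dots> = smallest_eigenvalue D"
    using eigenvector_rotation[OF D(1) U(1) n, of _ 0] U(2) v n by simp
  finally have val: "trace_form D (E_mat n * mat_adjoint U) = smallest_eigenvalue D" .
  from inv consider "right_unitarily_invariant n \<phi>" | "unitary_similarity_invariant n \<phi>"
    by (auto simp: weakly_unitarily_invariant_def)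
  then show ?thesis
  proof cases
    case 1
    then have "\<phi> (E_mat n * mat_adjoint U) = 1"
      using Ec Ua E by (simp add: right_unitarily_invariant_def)
    then show ?thesis
      using val Ec Uc by (intro bexI[of _ "E_mat n * mat_adjoint U"]) (auto simp: unit_sphere_def)
  next
    case 2
    then have "\<phi> (mat_adjoint (mat_adjoint U) * E_mat n * mat_adjoint U) = 1"
      using Ec Ua E by (simp only: unitary_similarity_invariant_def)
    then have "\<phi> (U * (E_mat n * mat_adjoint U)) = 1"
      using Ec Uc by (simp add: assoc_mult_mat[of _ n n _ n _ n])
    moreover have "trace_form D (U * (E_mat n * mat_adjoint U)) = smallest_eigenvalue D"
      using trace_form_unitary_left[OF _ D(1) U(1), of "E_mat n * mat_adjoint U"] val Ec Uc by simp
    ultimately show ?thesis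
      using Ec Uc by (intro bexI[of _ "U * (E_mat n * mat_adjoint U)"]) (auto simp: unit_sphere_def)
  qed
qed

lemma psd_one: "1\<^sub>m n \<in> psd_mats n"
proof -
  have "0 \<le> Re ((1\<^sub>m n *\<^sub>v v) \<bullet>c v)" if "v \<in> carrier_vec n" for v :: "complex vec"
    using that conj_sprod_self[of v] by (simp add: sum_nonneg)
  then show ?thesis by (auto simp: psd_mats_def)
qed

lemma m_equalsI:
  assumes "A \<in> S" "trace_form D A = c" "\<And>B. B \<in> S \<Longrightarrow> c \<le> trace_form D B"
  shows "m_equals D S c"
proof -
  have "(INF B\<in>S. trace_form D B) = c"
    using assms by (intro cInf_eq_minimum) auto
  then show ?thesis using assms by (auto simp: m_equals_def)
qed

theorem corollary3p12:
  fixes n :: nat and \<phi> :: "complex mat \<Rightarrow> real"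
  assumes "n > 0"
    and "\<phi> \<in> pos_homogeneous_funs n"
    and "weakly_unitarily_invariant n \<phi>"
    and "\<phi> (E_mat n) = 1"
  shows "(\<forall>\<Delta> \<in> psd_mats n. m_equals \<Delta> (unit_sphere n \<phi>) (smallest_eigenvalue \<Delta>))
     \<longleftrightarrow> (\<forall>A \<in> carrier_mat n n. \<phi> A \<le> norm2 A)"
proof
  assume "\<forall>\<Delta> \<in> psd_mats n. m_equals \<Delta> (unit_sphere n \<phi>) (smallest_eigenvalue \<Delta>)"
  then have "m_equals (1\<^sub>m n) (unit_sphere n \<phi>) 1"
    using psd_one smallest_eigenvalue_one[OF assms(1)] by metis
  then have inf: "(INF A\<in>unit_sphere n \<phi>. trace_form (1\<^sub>m n) A) = 1"
    by (simp add: m_equals_def)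
  have "bdd_below (trace_form (1\<^sub>m n) ` unit_sphere n \<phi>)"
    by (rule bdd_belowI[of _ 0]) (auto simp: unit_sphere_def simp flip: norm2_sq)
  then have sphere: "1 \<le> (norm2 B)\<^sup>2" if "B \<in> unit_sphere n \<phi>" for B
    using cINF_lower[of "trace_form (1\<^sub>m n)" "unit_sphere n \<phi>" B] that inf norm2_sq[of B n]
    by (simp add: unit_sphere_def)
  have hom: "\<phi> (complex_of_real a \<cdot>\<^sub>m A) = a * \<phi> A" if "a > 0" "A \<in> carrier_mat n n" for a A
    using assms(2) that unfolding pos_homogeneous_funs_def by blast
  show "\<forall>A \<in> carrier_mat n n. \<phi> A \<le> norm2 A"
  proof
    fix A :: "complex mat" assume A: "A \<in> carrier_mat n n"
    show "\<phi> A \<le> norm2 A"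
    proof (cases "\<phi> A > 0")
      case True
      let ?B = "complex_of_real (1 / \<phi> A) \<cdot>\<^sub>m A"
      have "\<phi> ?B = 1 / \<phi> A * \<phi> A"
        by (rule hom) (use A True in simp_all)
      then have "?B \<in> unit_sphere n \<phi>" using A True by (simp add: unit_sphere_def)
      then have "1\<^sup>2 \<le> (norm2 ?B)\<^sup>2" using sphere by simp
      then have "1 \<le> norm2 ?B"
        by (rule power2_le_imp_le) (use A in \<open>auto intro!: norm2_nonneg[of _ n]\<close>)
      also have "norm2 ?B = norm2 A / \<phi> A"
        using norm2_smult[OF A, of "1 / \<phi> A"] True by simp
      finally show ?thesis using True by (simp add: field_simps)
    next
      case False
      then show ?thesis using norm2_nonneg[OF A] by simp
    qed
  qed
next
  assume le: "\<forall>A \<in> carrier_mat n n. \<phi> A \<le> norm2 A"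
  show "\<forall>\<Delta> \<in> psd_mats n. m_equals \<Delta> (unit_sphere n \<phi>) (smallest_eigenvalue \<Delta>)"
  proof
    fix \<Delta> assume D: "\<Delta> \<in> psd_mats n"
    then have c: "\<Delta> \<in> carrier_mat n n" "mat_adjoint \<Delta> = \<Delta>" by (auto simp: psd_mats_def)
    obtain A where A: "A \<in> unit_sphere n \<phi>" "trace_form \<Delta> A = smallest_eigenvalue \<Delta>"
      using smallest_eigenvalue_attained[OF assms(1,3,4) c] by blast
    show "m_equals \<Delta> (unit_sphere n \<phi>) (smallest_eigenvalue \<Delta>)"
    proof (rule m_equalsI[OF A])
      fix B assume "B \<in> unit_sphere n \<phi>"
      then have B: "B \<in> carrier_mat n n" and "1 \<le> norm2 B"
        using le by (auto simp: unit_sphere_def)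
      then have "smallest_eigenvalue \<Delta> * 1 \<le> smallest_eigenvalue \<Delta> * (norm2 B)\<^sup>2"
        using smallest_eigenvalue_nonneg[OF assms(1) D]
        by (intro mult_left_mono one_le_power)
      also have "\<dots> \<le> trace_form \<Delta> B"
        by (rule smallest_eigenvalue_le_trace_form[OF assms(1) c B])
      finally show "smallest_eigenvalue \<Delta> \<le> trace_form \<Delta> B" by simp
    qed
  qed
qed

end
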